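(* Let $n\ge 1$, let $T=e_1T_1+e_2T_2\in L_1^n\times_eL_1^n$ be a linear operator on $\mathbb{C}_2^n$ (over $\mathbb{C}_1$), and let $\Upsilon_1,\Upsilon_2\subseteq\mathbb{C}_1$ be the sets of all eigenvalues of $T_1$ and $T_2$, respectively. Let $\kappa=\kappa_1e_1+\kappa_2e_2$ (with $\kappa_1,\kappa_2\in\mathbb{C}_1$) be a modified eigenvalue of $T$ such that $\kappa_1\in\Upsilon_1$ and $\kappa_2\in\Upsilon_2$. Then $${}^T(ME)_\kappa={}^{T_1}(E)_{\kappa_1}\times_e{}^{T_2}(E)_{\kappa_2}.$$
   Context: $\mathbb{C}_1$ denotes the complex numbers with imaginary unit $i_1$. The bicomplex numbers are $\mathbb{C}_2=\{z_1+i_2z_2 : z_1,z_2\in\mathbb{C}_1\}$, a commutative $\mathbb{C}_1$-algebra with $i_1^2=i_2^2=-1$, $i_1i_2=i_2i_1$. Put $e_1=(1+i_1i_2)/2$ and $e_2=(1-i_1i_2)/2$; these are idempotents with $e_1+e_2=1$, $e_1e_2=0$. Every $\xi=z_1+i_2z_2\in\mathbb{C}_2$ is uniquely $\xi=\xi^-e_1+\xi^+e_2$ with $\xi^-=z_1-i_1z_2$, $\xi^+=z_1+i_1z_2\in\mathbb{C}_1$. $\mathbb{C}_2^n$ is regarded as a vector space over $\mathbb{C}_1$; bicomplex scalars act on it componentwise. $L_1^n$ is the set of $\mathbb{C}_1$-linear operators $\mathbb{C}_1^n\to\mathbb{C}_1^n$. For $T_1,T_2\in L_1^n$, $T=e_1T_1+e_2T_2$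 is the $\mathbb{C}_1$-linear operator on $\mathbb{C}_2^n$ given by $T(\xi_1,\dots,\xi_n)=e_1T_1(\xi_1^-,\dots,\xi_n^-)+e_2T_2(\xi_1^+,\dots,\xi_n^+)$, and $L_1^n\times_eL_1^n$ is the set of all such operators. A scalar $\kappa\in\mathbb{C}_2$ is a modified eigenvalue of $T$ if there is a nonzero $x\in\mathbb{C}_2^n$ with $T(x)=\kappa x$; its modified eigenspace is ${}^T(ME)_\kappa=\{x\in\mathbb{C}_2^n : T(x)=\kappa x\}$. For an eigenvalue $z$ of $T_j$ ($j=1,2$), ${}^{T_j}(E)_z=\{v\in\mathbb{C}_1^n : T_j(v)=zv\}$. For $S_1,S_2\subseteq\mathbb{C}_1^n$, the idempotent product is $S_1\times_eS_2=\{e_1x+e_2y : x\in S_1,\ y\in S_2\}\subseteq\mathbb{C}_2^n$. *)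

theory Defs
  imports "HOL-Analysis.Analysis"
begin

text \<open>\<open>Bicomplex z\<^sub>1 z\<^sub>2\<close> is the bicomplex number \<open>z\<^sub>1 + i\<^sub>2 z\<^sub>2\<close>.\<close>

datatype bicomplex = Bicomplex (bc_fst: complex) (bc_snd: complex)

lemma bicomplex_eq_iff: "x = y \<longleftrightarrow> bc_fst x = bc_fst y \<and> bc_snd x = bc_snd y"
  by (cases x; cases y) simp

instantiation bicomplex :: comm_ring_1
begin

definition "0 = Bicomplex 0 0"
definition "1 = Bicomplex 1 0"
definition "x + y = Bicomplex (bc_fst x + bc_fst y) (bc_snd x + bc_snd y)"
definition "x - y = Bicomplex (bc_fst x - bc_fst y) (bc_snd x - bc_snd y)"
definition "- x = Bicomplex (- bc_fst x) (- bc_snd x)"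
definition "x * y = Bicomplex (bc_fst x * bc_fst y - bc_snd x * bc_snd y)
                              (bc_fst x * bc_snd y + bc_snd x * bc_fst y)"

instance
  by standard
     (auto simp: bicomplex_eq_iff zero_bicomplex_def one_bicomplex_def plus_bicomplex_def
        minus_bicomplex_def uminus_bicomplex_def times_bicomplex_def algebra_simps)

end

definition of_C1 :: "complex \<Rightarrow> bicomplex" where
  "of_C1 z = Bicomplex z 0"

definition i1 :: bicomplex where
  "i1 = of_C1 \<i>"

definition i2 :: bicomplex where
  "i2 = Bicomplex 0 1"

definition e1 :: bicomplex where
  "e1 = of_C1 (1 / 2) * (1 + i1 * i2)"

definition e2 :: bicomplex where
  "e2 = of_C1 (1 / 2) * (1 - i1 * i2)"

definition bc_minus :: "bicomplex \<Rightarrow> complex" where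
  "bc_minus \<xi> = bc_fst \<xi> - \<i> * bc_snd \<xi>"

definition bc_plus :: "bicomplex \<Rightarrow> complex" where
  "bc_plus \<xi> = bc_fst \<xi> + \<i> * bc_snd \<xi>"

lemmas bc_ops_defs = zero_bicomplex_def one_bicomplex_def plus_bicomplex_def
  minus_bicomplex_def uminus_bicomplex_def times_bicomplex_def

lemmas bc_elem_defs = of_C1_def i1_def i2_def e1_def e2_def

lemma bc_fst_snd: "Bicomplex z1 z2 = of_C1 z1 + i2 * of_C1 z2"
  by (simp add: bc_ops_defs bc_elem_defs)

lemma bc_units: "i1 * i1 = -1" "i2 * i2 = -1" "i1 * i2 = i2 * i1"
  by (simp_all add: bc_ops_defs bc_elem_defs)

lemma bc_idempotents: "e1 * e1 = e1" "e2 * e2 = e2" "e1 * e2 = 0" "e1 + e2 = 1"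
  by (simp_all add: bc_ops_defs bc_elem_defs field_simps)

lemma bc_idempotent_representation:
  "\<xi> = of_C1 a * e1 + of_C1 b * e2 \<longleftrightarrow> a = bc_minus \<xi> \<and> b = bc_plus \<xi>"
  by (auto simp: bicomplex_eq_iff bc_ops_defs bc_elem_defs bc_minus_def bc_plus_def
      field_simps complex_eq_iff)

text \<open>The module structures are those of the library: \<open>*s\<close> is the componentwise action of
  \<open>complex\<close> on \<open>complex ^ 'n\<close> and of \<open>bicomplex\<close> on \<open>bicomplex ^ 'n\<close>.  The action of
  complex scalars on \<open>bicomplex ^ 'n\<close> is the latter, restricted along \<^const>\<open>of_C1\<close>.\<close>

definition scaleC1 :: "complex \<Rightarrow> bicomplex ^ 'n \<Rightarrow> bicomplex ^ 'n" where
  "scaleC1 c x = of_C1 c *s x"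

definition vec_of_C1 :: "complex ^ 'n \<Rightarrow> bicomplex ^ 'n" where
  "vec_of_C1 v = (\<chi> i. of_C1 (v $ i))"

definition L1 :: "(complex ^ 'n \<Rightarrow> complex ^ 'n) set" where
  "L1 = {f. Vector_Spaces.linear (*s) (*s) f}"

definition idem_op ::
  "(complex ^ 'n \<Rightarrow> complex ^ 'n) \<Rightarrow> (complex ^ 'n \<Rightarrow> complex ^ 'n)
    \<Rightarrow> bicomplex ^ 'n \<Rightarrow> bicomplex ^ 'n" where
  "idem_op T1 T2 \<xi> =
     e1 *s vec_of_C1 (T1 (\<chi> i. bc_minus (\<xi> $ i))) + e2 *s vec_of_C1 (T2 (\<chi> i. bc_plus (\<xi> $ i)))"

definition L1_times_e_L1 :: "(bicomplex ^ 'n \<Rightarrow> bicomplex ^ 'n) set" where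
  "L1_times_e_L1 = {idem_op T1 T2 | T1 T2. T1 \<in> L1 \<and> T2 \<in> L1}"

definition eigenvalues :: "(complex ^ 'n \<Rightarrow> complex ^ 'n) \<Rightarrow> complex set" where
  "eigenvalues f = {z. \<exists>v. v \<noteq> 0 \<and> f v = z *s v}"

definition eigenspace :: "(complex ^ 'n \<Rightarrow> complex ^ 'n) \<Rightarrow> complex \<Rightarrow> (complex ^ 'n) set" where
  "eigenspace f z = {v. f v = z *s v}"

definition modified_eigenvalue :: "(bicomplex ^ 'n \<Rightarrow> bicomplex ^ 'n) \<Rightarrow> bicomplex \<Rightarrow> bool" where
  "modified_eigenvalue T \<kappa> \<longleftrightarrow> (\<exists>x. x \<noteq> 0 \<and> T x = \<kappa> *s x)"

definition modified_eigenspace ::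
  "(bicomplex ^ 'n \<Rightarrow> bicomplex ^ 'n) \<Rightarrow> bicomplex \<Rightarrow> (bicomplex ^ 'n) set" where
  "modified_eigenspace T \<kappa> = {x. T x = \<kappa> *s x}"

definition idem_prod ::
  "(complex ^ 'n) set \<Rightarrow> (complex ^ 'n) set \<Rightarrow> (bicomplex ^ 'n) set"  (infixr "\<times>\<^sub>e" 80) where
  "S1 \<times>\<^sub>e S2 = {e1 *s vec_of_C1 x + e2 *s vec_of_C1 y | x y. x \<in> S1 \<and> y \<in> S2}"

lemma vector_space_scaleC1: "vector_space (scaleC1 :: complex \<Rightarrow> bicomplex ^ 'n \<Rightarrow> bicomplex ^ 'n)"
  by unfold_locales
     (simp_all add: scaleC1_def vec_eq_iff bicomplex_eq_iff bc_ops_defs of_C1_def algebra_simps)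

lemma linear_idem_op:
  fixes T1 T2 :: "complex ^ 'n \<Rightarrow> complex ^ 'n"
  assumes "T1 \<in> L1" "T2 \<in> L1"
  shows "Vector_Spaces.linear scaleC1 scaleC1 (idem_op T1 T2)"
proof -
  interpret V: vector_space "scaleC1 :: complex \<Rightarrow> bicomplex ^ 'n \<Rightarrow> bicomplex ^ 'n"
    by (rule vector_space_scaleC1)
  have T: "Vector_Spaces.linear (*s) (*s) T1" "Vector_Spaces.linear (*s) (*s) T2"
    using assms by (simp_all add: L1_def)
  have add: "T1 (x + y) = T1 x + T1 y" "T2 (x + y) = T2 x + T2 y" for x y
    using T by (simp_all add: vec.linear_add)
  have scale: "T1 (c *s x) = c *s T1 x" "T2 (c *s x) = c *s T2 x" for c x
    using T by (simp_all add: vec.linear_scale)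
  have a: "(\<chi> i. bc_minus ((x + y) $ i)) = (\<chi> i. bc_minus (x $ i)) + (\<chi> i. bc_minus (y $ i))"
          "(\<chi> i. bc_plus ((x + y) $ i)) = (\<chi> i. bc_plus (x $ i)) + (\<chi> i. bc_plus (y $ i))"
    for x y :: "bicomplex ^ 'n"
    by (simp_all add: vec_eq_iff bc_minus_def bc_plus_def plus_bicomplex_def algebra_simps)
  have s: "(\<chi> i. bc_minus (scaleC1 c x $ i)) = c *s (\<chi> i. bc_minus (x $ i))"
          "(\<chi> i. bc_plus (scaleC1 c x $ i)) = c *s (\<chi> i. bc_plus (x $ i))"
    for c and x :: "bicomplex ^ 'n"
    by (simp_all add: vec_eq_iff scaleC1_def bc_minus_def bc_plus_def of_C1_def
        times_bicomplex_def algebra_simps)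
  show ?thesis
    unfolding linear_iff_module_hom module_hom_iff
    using V.module_axioms
    unfolding idem_op_def a s add scale
    by (auto simp: vec_eq_iff vec_of_C1_def scaleC1_def bicomplex_eq_iff plus_bicomplex_def
        times_bicomplex_def of_C1_def algebra_simps)
qed

end

theory Submission
  imports Defs
begin

text \<open>The maps \<open>\<xi> \<mapsto> \<xi>\<^sup>-\<close> and \<open>\<xi> \<mapsto> \<xi>\<^sup>+\<close> are ring homomorphisms from the bicomplex to the
  complex numbers, and together they identify the bicomplex numbers with \<open>\<complex> \<times> \<complex>\<close>
  (\<open>bicomplex_eq_iff_idempotent\<close>).  Applied componentwise, they split every bicomplex vector into
  two complex vectors.  Under this splitting \<open>idem_op T1 T2\<close> acts as \<open>T1\<close> on the first part and as
  \<open>T2\<close> on the second, and multiplication by \<open>\<kappa>\<close> acts as multiplication by \<open>\<kappa>1\<close> and \<open>\<kappa>2\<close>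
  respectively.  Hence the bicomplex equation \<open>T x = \<kappa> x\<close> is equivalent to the two complex
  equations \<open>T1 x\<^sup>- = \<kappa>1 x\<^sup>-\<close> and \<open>T2 x\<^sup>+ = \<kappa>2 x\<^sup>+\<close>, while the idempotent product of two sets
  consists of those \<open>x\<close> for which \<open>x\<^sup>-\<close> lies in the first set and \<open>x\<^sup>+\<close> in the second
  (\<open>mem_idem_prod_iff\<close>).\<close>

lemma bicomplex_eq_iff_idempotent:
  "\<xi> = \<eta> \<longleftrightarrow> bc_minus \<xi> = bc_minus \<eta> \<and> bc_plus \<xi> = bc_plus \<eta>"
  using bc_idempotent_representation by metis

lemma bc_minus_add: "bc_minus (\<xi> + \<eta>) = bc_minus \<xi> + bc_minus \<eta>"
  and bc_plus_add: "bc_plus (\<xi> + \<eta>) = bc_plus \<xi> + bc_plus \<eta>"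
  by (simp_all add: bc_minus_def bc_plus_def plus_bicomplex_def algebra_simps)

text \<open>Both maps substitute a square root of \<open>-1\<close> in the complex numbers for \<open>i2\<close>, namely
  \<open>-\<i>\<close> and \<open>\<i>\<close>; this is why they respect products.\<close>

lemma bc_minus_mult: "bc_minus (\<xi> * \<eta>) = bc_minus \<xi> * bc_minus \<eta>"
  and bc_plus_mult: "bc_plus (\<xi> * \<eta>) = bc_plus \<xi> * bc_plus \<eta>"
  by (simp_all add: bc_minus_def bc_plus_def times_bicomplex_def algebra_simps)

lemma bc_minus_of_C1: "bc_minus (of_C1 z) = z"
  and bc_plus_of_C1: "bc_plus (of_C1 z) = z"
  by (simp_all add: bc_minus_def bc_plus_def of_C1_def)

lemma bc_minus_e: "bc_minus e1 = 1" "bc_minus e2 = 0"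
  and bc_plus_e: "bc_plus e1 = 0" "bc_plus e2 = 1"
  by (simp_all add: bc_minus_def bc_plus_def bc_elem_defs bc_ops_defs)

lemmas idempotent_component_simps = bc_minus_add bc_plus_add bc_minus_mult bc_plus_mult
  bc_minus_of_C1 bc_plus_of_C1 bc_minus_e bc_plus_e

definition vec_minus :: "bicomplex ^ 'n \<Rightarrow> complex ^ 'n" where
  "vec_minus x = (\<chi> i. bc_minus (x $ i))"

definition vec_plus :: "bicomplex ^ 'n \<Rightarrow> complex ^ 'n" where
  "vec_plus x = (\<chi> i. bc_plus (x $ i))"

lemma vec_eq_iff_idempotent: "x = y \<longleftrightarrow> vec_minus x = vec_minus y \<and> vec_plus x = vec_plus y"
  by (auto simp: vec_eq_iff vec_minus_def vec_plus_def bicomplex_eq_iff_idempotent)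

lemma vec_minus_scale: "vec_minus (\<kappa> *s x) = bc_minus \<kappa> *s vec_minus x"
  and vec_plus_scale: "vec_plus (\<kappa> *s x) = bc_plus \<kappa> *s vec_plus x"
  by (simp_all add: vec_eq_iff vec_minus_def vec_plus_def idempotent_component_simps)

lemma vec_minus_combination: "vec_minus (e1 *s vec_of_C1 v + e2 *s vec_of_C1 w) = v"
  and vec_plus_combination: "vec_plus (e1 *s vec_of_C1 v + e2 *s vec_of_C1 w) = w"
  by (simp_all add: vec_eq_iff vec_minus_def vec_plus_def vec_of_C1_def idempotent_component_simps)

lemma vec_minus_idem_op: "vec_minus (idem_op T1 T2 x) = T1 (vec_minus x)"
  and vec_plus_idem_op: "vec_plus (idem_op T1 T2 x) = T2 (vec_plus x)"
  unfolding idem_op_def vec_minus_combination vec_plus_combination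
  by (simp_all add: vec_minus_def vec_plus_def)

lemma mem_idem_prod_iff: "x \<in> S1 \<times>\<^sub>e S2 \<longleftrightarrow> vec_minus x \<in> S1 \<and> vec_plus x \<in> S2"
proof
  assume "x \<in> S1 \<times>\<^sub>e S2"
  then show "vec_minus x \<in> S1 \<and> vec_plus x \<in> S2"
    by (auto simp: idem_prod_def vec_minus_combination vec_plus_combination)
next
  assume "vec_minus x \<in> S1 \<and> vec_plus x \<in> S2"
  moreover have "x = e1 *s vec_of_C1 (vec_minus x) + e2 *s vec_of_C1 (vec_plus x)"
    unfolding vec_eq_iff_idempotent vec_minus_combination vec_plus_combination by simp
  ultimately show "x \<in> S1 \<times>\<^sub>e S2"
    unfolding idem_prod_def by blast
qed

text \<open>Two bicomplex vectors agree exactly when both of their parts agree, so the eigenvector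
  equation can be checked on each part separately.\<close>

lemma modified_eigenspace_idem_op:
  "modified_eigenspace (idem_op T1 T2) \<kappa>
     = eigenspace T1 (bc_minus \<kappa>) \<times>\<^sub>e eigenspace T2 (bc_plus \<kappa>)"
proof (rule set_eqI)
  fix x
  have "idem_op T1 T2 x = \<kappa> *s x \<longleftrightarrow>
      T1 (vec_minus x) = bc_minus \<kappa> *s vec_minus x \<and> T2 (vec_plus x) = bc_plus \<kappa> *s vec_plus x"
    unfolding vec_eq_iff_idempotent[of "idem_op T1 T2 x"] vec_minus_idem_op vec_plus_idem_op
      vec_minus_scale vec_plus_scale ..
  then show "x \<in> modified_eigenspace (idem_op T1 T2) \<kappa> \<longleftrightarrow>
      x \<in> eigenspace T1 (bc_minus \<kappa>) \<times>\<^sub>e eigenspace T2 (bc_plus \<kappa>)"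
    by (simp add: modified_eigenspace_def eigenspace_def mem_idem_prod_iff)
qed

theorem theorem3p18:
  fixes T :: "bicomplex ^ 'n \<Rightarrow> bicomplex ^ 'n"
    and T1 T2 :: "complex ^ 'n \<Rightarrow> complex ^ 'n"
    and \<Upsilon>1 \<Upsilon>2 :: "complex set"
    and \<kappa> :: bicomplex
    and \<kappa>1 \<kappa>2 :: complex
  assumes "T1 \<in> L1" and "T2 \<in> L1"
    and "T \<in> L1_times_e_L1" and "T = idem_op T1 T2"
    and "\<Upsilon>1 = eigenvalues T1" and "\<Upsilon>2 = eigenvalues T2"
    and "\<kappa> = of_C1 \<kappa>1 * e1 + of_C1 \<kappa>2 * e2"
    and "modified_eigenvalue T \<kappa>"
    and "\<kappa>1 \<in> \<Upsilon>1" and "\<kappa>2 \<in> \<Upsilon>2"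
  shows "modified_eigenspace T \<kappa> = eigenspace T1 \<kappa>1 \<times>\<^sub>e eigenspace T2 \<kappa>2"
proof -
  have "\<kappa>1 = bc_minus \<kappa>" "\<kappa>2 = bc_plus \<kappa>"
    using bc_idempotent_representation \<open>\<kappa> = of_C1 \<kappa>1 * e1 + of_C1 \<kappa>2 * e2\<close> by auto
  then show ?thesis
    using modified_eigenspace_idem_op \<open>T = idem_op T1 T2\<close> by simp
qed

end
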